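(* Let $W:[0,\infty)\to[0,\infty)$ be such that $W(1)=0$, $W$ is decreasing on $(0,1]$ and increasing on $[1,\infty)$, and $W'(t)$ is non-decreasing on $(0,\infty)$. Suppose that, for every fixed $\lambda\ge1$ and $t>0$ (with $f(\cdot\mid t/\lambda)$ well defined), the equation $\int_{0}^{\infty}s\,W'(cs)\,f\left(s\mid \frac{t}{\lambda}\right)ds=0$ in $c\in(0,\infty)$ has a unique solution $c=\psi_\lambda(t)$, and $f\left(\frac{1}{\psi_\lambda(t)}\,\middle|\, \frac{t}{\lambda}\right)>0$. Let $\delta_\psi(\mathbf{X})=X_1\psi(T)$, with $\psi:(0,\infty)\to(0,\infty)$, be a scale equivariant estimator of $\theta_1$. Let $\underline{\psi}$ and $\overline{\psi}$ be functions on $(0,\infty)$ (with values in $[-\infty,\infty)$ and $(0,\infty]$, respectively) such that $\underline{\psi}(t)<\psi_\lambda(t)<\overline{\psi}(t)$ for all $\lambda\ge 1$ and all $t>0$. Define $$\psi^*(t)=\underline{\psi}(t)\vee(\psi(t)\wedge\overline{\psi}(t))=(\underline{\psi}(t)\vee\psi(t))\wedge\overline{\psi}(t),\qquad t>0,$$ and $\delta_{\psi^*}(\mathbf{X})=X_1\psi^*(T)$. Then $$R_1(\boldsymbol{\theta},\delta_\psi)\ \ge\ R_1(\boldsymbol{\theta},\delta_{\psi^*})\qquad\text{for every }\boldsymbol{\theta}\in\Theta_0 .$$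
   Context: Model: $\mathbf{X}=(X_1,X_2)$ has joint Lebesgue density $\frac{1}{\theta_1\theta_2}f\left(\frac{x_1}{\theta_1},\frac{x_2}{\theta_2}\right)$, where $f$ is a specified probability density whose support is contained in $(0,\infty)^2$, and $\boldsymbol{\theta}=(\theta_1,\theta_2)\in\Theta_0=\{(t_1,t_2)\in(0,\infty)^2: t_1\le t_2\}$ is unknown. Put $T=X_2/X_1$ and $\lambda=\theta_2/\theta_1\in[1,\infty)$. The risk of an estimator $\delta$ of $\theta_1$ is $R_1(\boldsymbol{\theta},\delta)=E_{\boldsymbol{\theta}}\left[W\left(\delta(\mathbf{X})/\theta_1\right)\right]\in[0,\infty]$. A scale equivariant estimator of $\theta_1$ is one of the form $\delta_\psi(\mathbf{X})=X_1\psi(T)$ with $\psi:(0,\infty)\to(0,\infty)$. All functions are Borel measurable. $x\vee y$ and $x\wedge y$ denote the maximum and minimum. Conditional density: $f(s\mid t)=\dfrac{s\,f(s,st)}{\int_{0}^{\infty}u\,f(u,ut)\,du}$, $s>0$ (the conditional density of $X_1/\theta_1$ given $T=t$ is $f(s\mid t/\lambda)$). *)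

theory Defs
  imports "HOL-Analysis.Analysis"
begin

text \<open>Only the set of positivity is required to lie in the open quadrant, not its closure, so that
  for example products of exponential densities are included.\<close>

definition quadrant_density :: "(real \<times> real \<Rightarrow> real) \<Rightarrow> bool" where
  "quadrant_density f \<longleftrightarrow>
     f \<in> borel_measurable borel \<and> (\<forall>x. 0 \<le> f x) \<and>
     (\<integral>\<^sup>+ x. ennreal (f x) \<partial>lborel) = 1 \<and>
     (\<forall>x. f x \<noteq> 0 \<longrightarrow> fst x > 0 \<and> snd x > 0)"

definition Theta0 :: "(real \<times> real) set" where
  "Theta0 = {(t1, t2). 0 < t1 \<and> 0 < t2 \<and> t1 \<le> t2}"

definition scale_law :: "(real \<times> real \<Rightarrow> real) \<Rightarrow> real \<times> real \<Rightarrow> (real \<times> real) measure" where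
  "scale_law f \<theta> = density lborel
     (\<lambda>x. ennreal (1 / (fst \<theta> * snd \<theta>) * f (fst x / fst \<theta>, snd x / snd \<theta>)))"

text \<open>The integrand is nonnegative wherever the law of the observation lives, so the truncation at
  0 performed by \<^const>\<open>ennreal\<close> has no effect; the risk may be infinite.\<close>

definition risk1 ::
  "(real \<Rightarrow> real) \<Rightarrow> (real \<times> real \<Rightarrow> real) \<Rightarrow> real \<times> real \<Rightarrow> (real \<times> real \<Rightarrow> real) \<Rightarrow> ennreal" where
  "risk1 W f \<theta> \<delta> = (\<integral>\<^sup>+ x. ennreal (W (\<delta> x / fst \<theta>)) \<partial>scale_law f \<theta>)"

definition equivariant :: "(real \<Rightarrow> real) \<Rightarrow> real \<times> real \<Rightarrow> real" where
  "equivariant \<psi> x = fst x * \<psi> (snd x / fst x)"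

text \<open>\<open>cond_density f s t\<close> is the conditional density written \<open>f(s | t)\<close>. It is well defined when
  its normalising integral is finite and nonzero; finiteness is required separately since the
  Bochner integral of a non-integrable function is 0 by convention.\<close>

definition cond_defined :: "(real \<times> real \<Rightarrow> real) \<Rightarrow> real \<Rightarrow> bool" where
  "cond_defined f t \<longleftrightarrow>
     set_integrable lborel {0<..} (\<lambda>u. u * f (u, u * t)) \<and>
     (LINT u:{0<..}|lborel. u * f (u, u * t)) > 0"

definition cond_density :: "(real \<times> real \<Rightarrow> real) \<Rightarrow> real \<Rightarrow> real \<Rightarrow> real" where
  "cond_density f s t = s * f (s, s * t) / (LINT u:{0<..}|lborel. u * f (u, u * t))"

text \<open>\<open>c\<close> solves \<open>\<integral> s W'(c s) f(s | t) ds = 0\<close>. A divergent integral does not count as 0.\<close>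

definition solves_eq ::
  "(real \<Rightarrow> real) \<Rightarrow> (real \<times> real \<Rightarrow> real) \<Rightarrow> real \<Rightarrow> real \<Rightarrow> bool" where
  "solves_eq W' f t c \<longleftrightarrow> c > 0 \<and>
     set_integrable lborel {0<..} (\<lambda>s. s * W' (c * s) * cond_density f s t) \<and>
     (LINT s:{0<..}|lborel. s * W' (c * s) * cond_density f s t) = 0"

text \<open>The extended real below is finite and positive whenever \<open>lo t < \<infinity>\<close>, \<open>0 < up t\<close> and
  \<open>0 < \<psi> t\<close>, so the conversion to \<^typ>\<open>real\<close> loses nothing.\<close>

definition truncated :: "(real \<Rightarrow> ereal) \<Rightarrow> (real \<Rightarrow> ereal) \<Rightarrow> (real \<Rightarrow> real) \<Rightarrow> real \<Rightarrow> real" where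
  "truncated lo up \<psi> t = real_of_ereal (max (lo t) (min (ereal (\<psi> t)) (up t)))"

end

theory Submission imports Defs begin

text \<open>In the coordinates \<open>x\<^sub>1 = \<theta>\<^sub>1 s\<close>, \<open>x\<^sub>2 = \<theta>\<^sub>2 s u\<close>, the ratio is \<open>T = \<lambda> u\<close> and the risk of
  \<open>\<delta>\<^sub>\<phi>\<close> is the integral over \<open>u\<close> of \<open>\<integral> W (s \<phi>(\<lambda> u)) s f(s, s u) ds\<close>. For almost every \<open>u\<close> the weight
  \<open>s f(s, s u)\<close> has finite mass, and it suffices to compare these inner integrals. The truncated value
  \<open>c\<^sup>* = \<psi>\<^sup>*(\<lambda> u)\<close> lies between \<open>c = \<psi>(\<lambda> u)\<close> and the stationary point \<open>c\<^sub>0 = \<psi>\<^sub>\<lambda>(\<lambda> u)\<close>, so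
  convexity of \<open>W\<close> gives \<open>W (c s) \<ge> W (c\<^sup>* s) + (c - c\<^sup>*) s W'(c\<^sub>0 s)\<close>, and the last term
  integrates to zero.\<close>

text \<open>Two affine substitutions, \<open>x1 = a * s\<close> and then
  \<open>x2 = (b * s) * u\<close> for fixed \<open>s\<close>, contribute the Jacobian
  \<open>a * b * \<bar>s\<bar>\<close>. Tonelli then makes the ratio \<open>u\<close> the outer
  variable, so that estimators can be compared one ratio at a time.\<close>

lemma nn_integral_lborel_ratio:
  fixes F :: "real \<times> real \<Rightarrow> ennreal" and a b :: real
  assumes F [measurable]: "F \<in> borel_measurable borel" and "a > 0" "b > 0"
  shows "(\<integral>\<^sup>+x. F x \<partial>lborel) =
    (\<integral>\<^sup>+u. \<integral>\<^sup>+s. ennreal (a * b * \<bar>s\<bar>) * F (a * s, b * (s * u)) \<partial>lborel \<partial>lborel)"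
proof -
  have F': "F \<in> borel_measurable (lborel \<Otimes>\<^sub>M lborel)"
    by (simp add: lborel_prod)
  have [measurable]: "F \<in> borel_measurable (borel \<Otimes>\<^sub>M borel)"
    by (simp add: borel_prod)
  have inner: "ennreal a * (\<integral>\<^sup>+y. F (a * s, y) \<partial>lborel) =
      (\<integral>\<^sup>+u. ennreal (a * b * \<bar>s\<bar>) * F (a * s, b * (s * u)) \<partial>lborel)" if "s \<noteq> 0" for s
  proof -
    have "(\<integral>\<^sup>+y. F (a * s, y) \<partial>lborel) =
        ennreal \<bar>b * s\<bar> * (\<integral>\<^sup>+u. F (a * s, 0 + (b * s) * u) \<partial>lborel)"
      using assms that by (intro nn_integral_real_affine) auto
    moreover have "ennreal a * ennreal \<bar>b * s\<bar> = ennreal (a * b * \<bar>s\<bar>)"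
      using assms by (simp add: ennreal_mult[symmetric] abs_mult mult.assoc)
    ultimately show ?thesis
      by (simp add: nn_integral_cmult mult.assoc[symmetric])
  qed
  have "(\<integral>\<^sup>+x. F x \<partial>lborel) = (\<integral>\<^sup>+x. \<integral>\<^sup>+y. F (x, y) \<partial>lborel \<partial>lborel)"
    using lborel.nn_integral_fst[OF F'] by (simp add: lborel_prod)
  also have "\<dots> = ennreal \<bar>a\<bar> * (\<integral>\<^sup>+s. \<integral>\<^sup>+y. F (0 + a * s, y) \<partial>lborel \<partial>lborel)"
    using assms by (intro nn_integral_real_affine) auto
  also have "\<dots> = (\<integral>\<^sup>+s. ennreal a * (\<integral>\<^sup>+y. F (a * s, y) \<partial>lborel) \<partial>lborel)"
    using assms by (simp add: nn_integral_cmult)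
  also have "\<dots> =
      (\<integral>\<^sup>+s. \<integral>\<^sup>+u. ennreal (a * b * \<bar>s\<bar>) * F (a * s, b * (s * u)) \<partial>lborel \<partial>lborel)"
    \<comment> \<open>The second substitution degenerates at \<open>s = 0\<close>, which is a null
      set.\<close>
    by (rule nn_integral_cong_AE, rule AE_mp[OF AE_lborel_singleton[of 0]]) (simp add: inner)
  also have "\<dots> =
      (\<integral>\<^sup>+u. \<integral>\<^sup>+s. ennreal (a * b * \<bar>s\<bar>) * F (a * s, b * (s * u)) \<partial>lborel \<partial>lborel)"
    by (rule lborel_pair.Fubini') measurable
  finally show ?thesis .
qed

text \<open>Moving \<open>c\<close> towards \<open>c0\<close> cannot increase the integrated loss.
  The weight \<open>h\<close> stands for a conditional density up to a constant factor. Stationarity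
  enters only through the integral of \<open>W'\<close> at \<open>c0\<close>, so nothing is
  differentiated under the integral sign.\<close>

lemma nn_integral_le_towards_stationary:
  fixes W W' h :: "real \<Rightarrow> real" and c c' c0 :: real
  assumes W_nonneg: "\<And>x. x \<ge> 0 \<Longrightarrow> W x \<ge> 0"
    and W_deriv: "\<And>x. x > 0 \<Longrightarrow> (W has_real_derivative W' x) (at x)"
    and W'_mono: "mono_on {0<..} W'"
    and h: "h \<in> borel_measurable borel" "\<And>s. 0 \<le> h s" "\<And>s. s \<le> 0 \<Longrightarrow> h s = 0"
    and pos: "0 < c" "0 < c'" "0 < c0"
    and between: "c \<le> c' \<and> c' \<le> c0 \<or> c0 \<le> c' \<and> c' \<le> c"
    and int: "integrable lborel (\<lambda>s. s * W' (c0 * s) * h s)"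
    and zero: "(\<integral>s. s * W' (c0 * s) * h s \<partial>lborel) = 0"
  shows "(\<integral>\<^sup>+s. ennreal (W (c' * s) * h s) \<partial>lborel) \<le> (\<integral>\<^sup>+s. ennreal (W (c * s) * h s) \<partial>lborel)"
proof (cases "(\<integral>\<^sup>+s. ennreal (W (c * s) * h s) \<partial>lborel) < \<infinity>")
  case False
  then show ?thesis by (simp add: less_top[symmetric])
next
  case True
  have "convex_on {0<..} W"
    by (rule convex_on_realI[where f' = W']) (use W_deriv W'_mono in \<open>auto simp: mono_on_def\<close>)
  then have tangent: "W' x * (y - x) \<le> W y - W x" if "x > 0" "y > 0" for x y
    using that W_deriv[of x]
    by (intro convex_on_imp_above_tangent[where A = "{0<..}"])
       (auto simp: interior_open has_field_derivative_at_within)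
  have nonneg: "0 \<le> W (d * s) * h s" if "d > 0" for d s
    using that h(2)[of s] h(3)[of s] W_nonneg[of "d * s"] by (cases "s \<le> 0") auto
  have le: "W (c' * s) * h s \<le> W (c * s) * h s - (c - c') * (s * W' (c0 * s) * h s)" for s
  proof (cases "s > 0")
    case True
    \<comment> \<open>The tangent at \<open>c' * s\<close> has slope \<open>W' (c' * s)\<close>, but
      only the slope at \<open>c0 * s\<close> is known to integrate to zero. The exchange goes the
      right way because \<open>c - c'\<close> and \<open>W' (c' * s) - W' (c0 * s)\<close> never
      have opposite signs, in either ordering.\<close>
    have "(c - c') * (s * W' (c0 * s)) \<le> W' (c' * s) * (c * s - c' * s)"
    proof -
      have "0 \<le> (c - c') * s * (W' (c' * s) - W' (c0 * s))"
        using between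
      proof
        assume *: "c \<le> c' \<and> c' \<le> c0"
        then have "W' (c' * s) \<le> W' (c0 * s)"
          using True pos by (intro mono_onD[OF W'_mono]) auto
        then show ?thesis
          using * True by (intro mult_nonpos_nonpos mult_nonpos_nonneg) auto
      next
        assume *: "c0 \<le> c' \<and> c' \<le> c"
        then have "W' (c0 * s) \<le> W' (c' * s)"
          using True pos by (intro mono_onD[OF W'_mono]) auto
        then show ?thesis
          using * True by (intro mult_nonneg_nonneg) auto
      qed
      then show ?thesis by (simp add: algebra_simps)
    qed
    also have "\<dots> \<le> W (c * s) - W (c' * s)"
      using True pos by (intro tangent) auto
    finally have "W (c' * s) \<le> W (c * s) - (c - c') * (s * W' (c0 * s))"
      by simp
    from mult_right_mono[OF this h(2)[of s]] show ?thesis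
      by (simp add: algebra_simps)
  qed (simp add: h)
  \<comment> \<open>Differentiability gives continuity, hence measurability, only on the positive
    half-line. Since \<open>h\<close> vanishes off it, an indicator can be inserted without changing
    the product.\<close>
  have "continuous_on {0<..} W"
    using W_deriv by (intro continuous_at_imp_continuous_on) (auto intro: DERIV_isCont)
  then have W_cont: "(\<lambda>x. indicator {0<..} x *\<^sub>R W x) \<in> borel_measurable borel"
    by (intro borel_measurable_continuous_on_indicator) auto
  have "(\<lambda>s. (indicator {0<..} (c * s) *\<^sub>R W (c * s)) * h s) \<in> borel_measurable borel"
    using h(1) by (intro borel_measurable_times measurable_compose[OF _ W_cont]) auto
  also have "(\<lambda>s. (indicator {0<..} (c * s) *\<^sub>R W (c * s)) * h s) = (\<lambda>s. W (c * s) * h s)"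
    using h(3) pos by (auto simp: indicator_def zero_less_mult_iff not_less fun_eq_iff)
  finally have Wint: "integrable lborel (\<lambda>s. W (c * s) * h s)"
    using True nonneg[OF pos(1)] by (intro integrableI_nonneg) auto
  have "(\<integral>\<^sup>+s. ennreal (W (c' * s) * h s) \<partial>lborel)
      \<le> (\<integral>\<^sup>+s. ennreal (W (c * s) * h s - (c - c') * (s * W' (c0 * s) * h s)) \<partial>lborel)"
    by (intro nn_integral_mono ennreal_leI le)
  \<comment> \<open>The difference dominates the nonnegative \<open>W (c' * s) * h s\<close>, so
    \<open>ennreal\<close> truncates nothing and the integral may be split linearly.\<close>
  also have "\<dots> = ennreal (\<integral>s. W (c * s) * h s - (c - c') * (s * W' (c0 * s) * h s) \<partial>lborel)"
    using Wint int
    by (intro nn_integral_eq_integral Bochner_Integration.integrable_diff integrable_mult_right AE_I2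
        order_trans[OF nonneg[OF pos(2)] le])
  also have "(\<integral>s. W (c * s) * h s - (c - c') * (s * W' (c0 * s) * h s) \<partial>lborel) =
      (\<integral>s. W (c * s) * h s \<partial>lborel) - (c - c') * (\<integral>s. s * W' (c0 * s) * h s \<partial>lborel)"
    using Wint int by (subst Bochner_Integration.integral_diff) auto
  also have "ennreal \<dots> = (\<integral>\<^sup>+s. ennreal (W (c * s) * h s) \<partial>lborel)"
    using nn_integral_eq_integral[OF Wint] nonneg[OF pos(1)] zero by simp
  finally show ?thesis .
qed

text \<open>Taking \<open>a\<close> and \<open>b\<close> to be the two scale parameters cancels the
  prefactor of the density and turns the scaled estimate into
  \<open>\<phi> (\<lambda> u) * s\<close>. The parameters survive only through their
  quotient.\<close>

lemma risk1_equivariant: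
  fixes f :: "real \<times> real \<Rightarrow> real" and W \<phi> :: "real \<Rightarrow> real" and \<theta> :: "real \<times> real"
  assumes f: "quadrant_density f"
    and W: "W \<in> borel_measurable (restrict_space borel {0..})"
    and W_nonneg: "\<And>x. x \<ge> 0 \<Longrightarrow> W x \<ge> 0"
    and \<phi>: "\<phi> \<in> borel_measurable (restrict_space borel {0<..})"
    and \<phi>_pos: "\<And>t. t > 0 \<Longrightarrow> \<phi> t > 0"
    and \<theta>: "fst \<theta> > 0" "snd \<theta> > 0"
  shows "risk1 W f \<theta> (equivariant \<phi>) =
    (\<integral>\<^sup>+u. \<integral>\<^sup>+s. ennreal (W (\<phi> (snd \<theta> / fst \<theta> * u) * s) * (s * f (s, s * u))) \<partial>lborel \<partial>lborel)"
proof -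
  obtain a b where ab: "\<theta> = (a, b)" "a > 0" "b > 0"
    using \<theta> by (cases \<theta>) auto
  \<comment> \<open>\<open>W\<close> and \<open>\<phi>\<close> are measurable only relative to their
    domains. Extension by zero makes them Borel on the whole line, and the law, carried by the open
    quadrant, does not see the change.\<close>
  define W0 where "W0 = (\<lambda>x. if x \<in> {0..} then W x else 0)"
  define \<phi>0 where "\<phi>0 = (\<lambda>t. if t \<in> {0<..} then \<phi> t else 0)"
  have [measurable]: "W0 \<in> borel_measurable borel" "\<phi>0 \<in> borel_measurable borel"
    unfolding W0_def \<phi>0_def using W \<phi> by (simp_all add: measurable_restrict_space_iff)
  have [measurable]: "f \<in> borel_measurable borel"
    and f_nonneg: "\<And>x. 0 \<le> f x"
    and f_supp: "\<And>x y. f (x, y) \<noteq> 0 \<Longrightarrow> x > 0 \<and> y > 0"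
    using f by (force simp: quadrant_density_def)+
  have [measurable]: "f \<in> borel_measurable (borel \<Otimes>\<^sub>M borel)"
    by (simp add: borel_prod)
  define p where "p = (\<lambda>x. ennreal (1 / (a * b) * f (fst x / a, snd x / b)))"
  define G where "G = (\<lambda>x. ennreal (W0 (equivariant \<phi>0 x / a)))"
  have "p \<in> borel_measurable (borel \<Otimes>\<^sub>M borel)"
    unfolding p_def by measurable
  then have p [measurable]: "p \<in> borel_measurable lborel"
    by (simp add: borel_prod)
  have "G \<in> borel_measurable (borel \<Otimes>\<^sub>M borel)"
    unfolding G_def equivariant_def by measurable
  then have G [measurable]: "G \<in> borel_measurable lborel"
    by (simp add: borel_prod)
  have pG [measurable]: "(\<lambda>x. p x * G x) \<in> borel_measurable borel"
    using p G by simp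
  have "risk1 W f \<theta> (equivariant \<phi>) =
      (\<integral>\<^sup>+x. ennreal (W (equivariant \<phi> x / a)) \<partial>density lborel p)"
    by (simp add: risk1_def scale_law_def p_def ab)
  also have "\<dots> = (\<integral>\<^sup>+x. G x \<partial>density lborel p)"
  proof (rule nn_integral_cong_AE, subst AE_density[OF p], rule AE_I2, rule impI)
    fix x :: "real \<times> real"
    assume "0 < p x"
    then have "f (fst x / a, snd x / b) \<noteq> 0"
      by (auto simp: p_def)
    from f_supp[OF this] have "fst x > 0" "snd x > 0"
      using ab by (auto simp: zero_less_divide_iff)
    then show "ennreal (W (equivariant \<phi> x / a)) = G x"
      using ab \<phi>_pos[of "snd x / fst x"]
      by (auto simp: G_def W0_def \<phi>0_def equivariant_def zero_le_mult_iff zero_le_divide_iff)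
  qed
  also have "\<dots> = (\<integral>\<^sup>+x. p x * G x \<partial>lborel)"
    by (rule nn_integral_density) measurable
  also have "\<dots> = (\<integral>\<^sup>+u. \<integral>\<^sup>+s. ennreal (a * b * \<bar>s\<bar>) *
      (p (a * s, b * (s * u)) * G (a * s, b * (s * u))) \<partial>lborel \<partial>lborel)"
    by (rule nn_integral_lborel_ratio[OF pG ab(2,3)])
  also have "\<dots> = (\<integral>\<^sup>+u. \<integral>\<^sup>+s. ennreal (W (\<phi> (b / a * u) * s) * (s * f (s, s * u))) \<partial>lborel \<partial>lborel)"
  proof (intro nn_integral_cong)
    fix u s :: real
    show "ennreal (a * b * \<bar>s\<bar>) * (p (a * s, b * (s * u)) * G (a * s, b * (s * u))) =
        ennreal (W (\<phi> (b / a * u) * s) * (s * f (s, s * u)))"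
    \<comment> \<open>Where \<open>f\<close> vanishes, both sides are zero whatever \<open>W\<close>
      and \<open>\<phi>\<close> do outside their domains. Elsewhere \<open>s\<close> and
      \<open>u\<close> are positive.\<close>
    proof (cases "f (s, s * u) = 0")
      case True
      then show ?thesis using ab by (simp add: p_def)
    next
      case False
      then have s: "s > 0" and "s * u > 0"
        using f_supp by auto
      then have u: "u > 0"
        by (simp add: zero_less_mult_iff)
      have bau: "b / a * u > 0"
        using ab u by simp
      have ratio: "b * (s * u) / (a * s) = b / a * u"
        using ab s by (simp add: field_simps)
      have G': "G (a * s, b * (s * u)) = ennreal (W (\<phi> (b / a * u) * s))"
      proof -
        have "equivariant \<phi>0 (a * s, b * (s * u)) / a = \<phi> (b / a * u) * s"
          using ab bau by (simp add: equivariant_def ratio \<phi>0_def)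
        moreover have "0 \<le> \<phi> (b / a * u) * s"
          using s \<phi>_pos[OF bau] by simp
        ultimately show ?thesis
          by (simp add: G_def W0_def)
      qed
      have p': "p (a * s, b * (s * u)) = ennreal (f (s, s * u) / (a * b))"
        using ab by (simp add: p_def)
      have "0 \<le> W (\<phi> (b / a * u) * s)"
        using s \<phi>_pos[OF bau] by (intro W_nonneg) simp
      then show ?thesis
        using ab s f_nonneg[of "(s, s * u)"]
        by (simp add: G' p' ennreal_mult[symmetric] mult_ac)
    qed
  qed
  finally show ?thesis by (simp add: ab)
qed

text \<open>By the substitution with \<open>a = b = 1\<close>, these masses integrate over
  \<open>u\<close> to the total mass 1. Divergence of the normalising integral is thus confined to a
  null set of ratios.\<close>

lemma AE_ratio_mass_finite:
  assumes f: "quadrant_density f"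
  shows "AE u in lborel. (\<integral>\<^sup>+s. ennreal (s * f (s, s * u)) \<partial>lborel) \<noteq> \<infinity>"
proof (rule nn_integral_PInf_AE)
  have [measurable]: "f \<in> borel_measurable borel"
    and f_supp: "\<And>x y. f (x, y) \<noteq> 0 \<Longrightarrow> x > 0"
    and total: "(\<integral>\<^sup>+x. ennreal (f x) \<partial>lborel) = 1"
    using f by (force simp: quadrant_density_def)+
  have [measurable]: "f \<in> borel_measurable (borel \<Otimes>\<^sub>M borel)"
    by (simp add: borel_prod)
  show "(\<lambda>u. \<integral>\<^sup>+s. ennreal (s * f (s, s * u)) \<partial>lborel) \<in> borel_measurable lborel"
    by measurable
  have "(\<integral>\<^sup>+u. \<integral>\<^sup>+s. ennreal (s * f (s, s * u)) \<partial>lborel \<partial>lborel) =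
      (\<integral>\<^sup>+u. \<integral>\<^sup>+s. ennreal (1 * 1 * \<bar>s\<bar>) * ennreal (f (1 * s, 1 * (s * u))) \<partial>lborel \<partial>lborel)"
  proof (intro nn_integral_cong)
    fix u s :: real
    show "ennreal (s * f (s, s * u)) = ennreal (1 * 1 * \<bar>s\<bar>) * ennreal (f (1 * s, 1 * (s * u)))"
      using f_supp[of s "s * u"] by (cases "f (s, s * u) = 0") (auto simp: ennreal_mult')
  qed
  also have "\<dots> = (\<integral>\<^sup>+x. ennreal (f x) \<partial>lborel)"
    by (rule nn_integral_lborel_ratio[symmetric]) auto
  finally show "(\<integral>\<^sup>+u. \<integral>\<^sup>+s. ennreal (s * f (s, s * u)) \<partial>lborel \<partial>lborel) \<noteq> \<infinity>"
    using total by simp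
qed

text \<open>The inner minimum is positive and finite; a maximum with something below infinity keeps
  it so. Infinite values of \<open>lo\<close> and \<open>up\<close> are therefore harmless.\<close>

lemma ereal_truncated:
  assumes "\<psi> t > 0" "lo t < \<infinity>" "0 < up t"
  shows "ereal (truncated lo up \<psi> t) = max (lo t) (min (ereal (\<psi> t)) (up t))"
    and "truncated lo up \<psi> t > 0"
proof -
  have "0 < min (ereal (\<psi> t)) (up t)" "min (ereal (\<psi> t)) (up t) < \<infinity>"
    using assms by (auto simp: min_def)
  then have "0 < max (lo t) (min (ereal (\<psi> t)) (up t))" "max (lo t) (min (ereal (\<psi> t)) (up t)) < \<infinity>"
    using assms(2) by (auto simp only: less_max_iff_disj max_less_iff_conj)
  then show "ereal (truncated lo up \<psi> t) = max (lo t) (min (ereal (\<psi> t)) (up t))"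
    and "truncated lo up \<psi> t > 0"
    by (cases "max (lo t) (min (ereal (\<psi> t)) (up t))"; simp add: truncated_def)+
qed

text \<open>The two clamping formulas agree only if \<open>lo t \<le> up t\<close>. This follows as
  soon as some \<open>\<psi>opt l t\<close> is known to lie between the bounds, hence the guard in
  the first conjunct.\<close>

theorem theorem3p1p1:
  fixes f :: "real \<times> real \<Rightarrow> real"
    and W W' :: "real \<Rightarrow> real"
    and \<psi>opt :: "real \<Rightarrow> real \<Rightarrow> real"
    and \<psi> :: "real \<Rightarrow> real"
    and lo up :: "real \<Rightarrow> ereal"
  assumes f: "quadrant_density f"
    and W_meas: "W \<in> borel_measurable (restrict_space borel {0..})"
    and W_nonneg: "\<And>x. x \<ge> 0 \<Longrightarrow> W x \<ge> 0"
    and W_1: "W 1 = 0"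
    and W_decreasing: "antimono_on {0<..1} W"
    and W_increasing: "mono_on {1..} W"
    and W_deriv: "\<And>x. x > 0 \<Longrightarrow> (W has_real_derivative W' x) (at x)"
    and W'_mono: "mono_on {0<..} W'"
    and \<psi>opt_solves: "\<And>l t. l \<ge> 1 \<Longrightarrow> t > 0 \<Longrightarrow> cond_defined f (t / l) \<Longrightarrow>
          solves_eq W' f (t / l) (\<psi>opt l t)"
    and \<psi>opt_unique: "\<And>l t c. l \<ge> 1 \<Longrightarrow> t > 0 \<Longrightarrow> cond_defined f (t / l) \<Longrightarrow>
          solves_eq W' f (t / l) c \<Longrightarrow> c = \<psi>opt l t"
    and \<psi>opt_density: "\<And>l t. l \<ge> 1 \<Longrightarrow> t > 0 \<Longrightarrow> cond_defined f (t / l) \<Longrightarrow>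
          cond_density f (1 / \<psi>opt l t) (t / l) > 0"
    and \<psi>_meas: "\<psi> \<in> borel_measurable (restrict_space borel {0<..})"
    and \<psi>_pos: "\<And>t. t > 0 \<Longrightarrow> \<psi> t > 0"
    and lo_meas: "lo \<in> borel_measurable (restrict_space borel {0<..})"
    and up_meas: "up \<in> borel_measurable (restrict_space borel {0<..})"
    and lo_range: "\<And>t. t > 0 \<Longrightarrow> lo t < \<infinity>"
    and up_range: "\<And>t. t > 0 \<Longrightarrow> 0 < up t"
    and bounds: "\<And>l t. l \<ge> 1 \<Longrightarrow> t > 0 \<Longrightarrow> cond_defined f (t / l) \<Longrightarrow>
          lo t < ereal (\<psi>opt l t) \<and> ereal (\<psi>opt l t) < up t"
  shows "(\<forall>t>0. (\<exists>l\<ge>1. cond_defined f (t / l)) \<longrightarrow>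
            max (lo t) (min (ereal (\<psi> t)) (up t)) = min (max (lo t) (ereal (\<psi> t))) (up t)) \<and>
         (\<forall>\<theta>\<in>Theta0. risk1 W f \<theta> (equivariant \<psi>) \<ge> risk1 W f \<theta> (equivariant (truncated lo up \<psi>)))"
proof (intro conjI allI impI ballI)
  fix t :: real
  assume "t > 0" "\<exists>l\<ge>1. cond_defined f (t / l)"
  then obtain l where "lo t < ereal (\<psi>opt l t)" "ereal (\<psi>opt l t) < up t"
    using bounds by blast
  then have "lo t \<le> up t" by simp
  then show "max (lo t) (min (ereal (\<psi> t)) (up t)) = min (max (lo t) (ereal (\<psi> t))) (up t)"
    by (auto simp: max_def min_def)
next
  fix \<theta> assume "\<theta> \<in> Theta0"
  then have \<theta>: "fst \<theta> > 0" "snd \<theta> > 0" "fst \<theta> \<le> snd \<theta>"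
    by (auto simp: Theta0_def)
  define l where "l = snd \<theta> / fst \<theta>"
  have l: "l \<ge> 1" using \<theta> by (simp add: l_def)
  have [measurable]: "f \<in> borel_measurable borel"
    and f_nonneg: "\<And>x. 0 \<le> f x"
    and f_supp: "\<And>x y. f (x, y) \<noteq> 0 \<Longrightarrow> x > 0 \<and> y > 0"
    using f by (force simp: quadrant_density_def)+
  have [measurable]: "f \<in> borel_measurable (borel \<Otimes>\<^sub>M borel)"
    by (simp add: borel_prod)
  let ?\<psi>' = "truncated lo up \<psi>"
  have trunc_meas: "?\<psi>' \<in> borel_measurable (restrict_space borel {0<..})"
    unfolding truncated_def using lo_meas up_meas \<psi>_meas by measurable
  note trunc = ereal_truncated[of \<psi> _ lo up, OF \<psi>_pos lo_range up_range]
  have "(\<integral>\<^sup>+s. ennreal (W (?\<psi>' (l * u) * s) * (s * f (s, s * u))) \<partial>lborel)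
      \<le> (\<integral>\<^sup>+s. ennreal (W (\<psi> (l * u) * s) * (s * f (s, s * u))) \<partial>lborel)"
    if fin: "(\<integral>\<^sup>+s. ennreal (s * f (s, s * u)) \<partial>lborel) \<noteq> \<infinity>" for u
  proof -
    define h where "h = (\<lambda>s. s * f (s, s * u))"
    have h [measurable]: "h \<in> borel_measurable borel"
      unfolding h_def by measurable
    have h_supp: "h s \<noteq> 0 \<Longrightarrow> s > 0 \<and> u > 0" for s
      using f_supp[of s "s * u"] by (auto simp: h_def zero_less_mult_iff)
    have h_nonneg: "0 \<le> h s" for s
      using h_supp[of s] f_nonneg by (cases "h s = 0") (auto simp: h_def)
    have h_int: "integrable lborel h"
      using fin h h_nonneg by (intro integrableI_nonneg) (auto simp: h_def less_top)
    \<comment> \<open>This turns the set integrals in the definitions into integrals over the whole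
      line.\<close>
    have on_pos: "(\<lambda>s. indicator {0<..} s *\<^sub>R (g s * h s)) = (\<lambda>s. g s * h s)" for g
      using h_supp by (fastforce simp: indicator_def fun_eq_iff)
    define D where "D = (\<integral>s. h s \<partial>lborel)"
    have D: "(LINT v:{0<..}|lborel. v * f (v, v * u)) = D"
      using on_pos[of "\<lambda>_. 1"] by (simp add: set_lebesgue_integral_def D_def h_def)
    show ?thesis
    \<comment> \<open>With zero mass the conditional density is undefined, but \<open>h\<close>
      vanishes almost everywhere and the left side is zero.\<close>
    proof (cases "D = 0")
      case True
      then have "AE s in lborel. h s = 0"
        using integral_nonneg_eq_0_iff_AE[OF h_int] h_nonneg by (simp add: D_def)
      then have "(\<integral>\<^sup>+s. ennreal (W (?\<psi>' (l * u) * s) * h s) \<partial>lborel) = (\<integral>\<^sup>+s. 0 \<partial>(lborel :: real measure))"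
        by (intro nn_integral_cong_AE) auto
      then show ?thesis by (simp add: h_def)
    next
      case False
      then have D_pos: "D > 0"
        using Bochner_Integration.integral_nonneg[of lborel h] h_nonneg by (simp add: D_def less_le)
      have "\<exists>s. h s \<noteq> 0"
        by (rule ccontr) (use False in \<open>simp add: D_def\<close>)
      then have u: "u > 0" using h_supp by blast
      \<comment> \<open>\<open>t\<close> is the observed ratio and \<open>u = t / l\<close> its
        standardised value, at which the conditional density is evaluated.\<close>
      define t where "t = l * u"
      have t: "t > 0" "t / l = u" using l u by (auto simp: t_def)
      have "set_integrable lborel {0<..} (\<lambda>v. v * f (v, v * u))"
        using on_pos[of "\<lambda>_. 1"] h_int by (simp add: set_integrable_def h_def)
      then have cd: "cond_defined f (t / l)"
        using D D_pos by (simp add: cond_defined_def t)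
      define c0 where "c0 = \<psi>opt l t"
      have sol: "solves_eq W' f u c0"
        using \<psi>opt_solves[OF l t(1) cd] by (simp add: t c0_def)
      have cond: "cond_density f s u = h s / D" for s
        by (simp add: cond_density_def D h_def)
      \<comment> \<open>Normalisation is only the constant factor \<open>inverse D\<close>, so
        integrability and the zero integral pass to \<open>h\<close>.\<close>
      have eq: "(\<lambda>s. indicator {0<..} s *\<^sub>R (s * W' (c0 * s) * cond_density f s u)) =
          (\<lambda>s. s * W' (c0 * s) * h s * inverse D)"
        using on_pos[of "\<lambda>s. s * W' (c0 * s) / D"] by (simp add: cond divide_inverse mult_ac)
      have c0: "c0 > 0"
        and int: "integrable lborel (\<lambda>s. s * W' (c0 * s) * h s)"
        and zero: "(\<integral>s. s * W' (c0 * s) * h s \<partial>lborel) = 0"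
        using sol D_pos unfolding solves_eq_def set_integrable_def set_lebesgue_integral_def eq
        by auto
      have lo_up: "lo t < ereal c0" "ereal c0 < up t"
        using bounds[OF l t(1) cd] by (auto simp: c0_def)
      \<comment> \<open>Clamping to an interval that contains \<open>c0\<close> moves a point
        towards \<open>c0\<close> without passing it, or leaves it fixed.\<close>
      have "\<psi> t \<le> ?\<psi>' t \<and> ?\<psi>' t \<le> c0 \<or> c0 \<le> ?\<psi>' t \<and> ?\<psi>' t \<le> \<psi> t"
      proof -
        have "ereal (\<psi> t) \<le> ereal (?\<psi>' t) \<and> ereal (?\<psi>' t) \<le> ereal c0 \<or>
            ereal c0 \<le> ereal (?\<psi>' t) \<and> ereal (?\<psi>' t) \<le> ereal (\<psi> t)"
          unfolding trunc(1)[OF t(1) t(1) t(1)] using lo_up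
          by (auto simp: max_def min_def)
        then show ?thesis by simp
      qed
      then have "(\<integral>\<^sup>+s. ennreal (W (?\<psi>' t * s) * h s) \<partial>lborel)
          \<le> (\<integral>\<^sup>+s. ennreal (W (\<psi> t * s) * h s) \<partial>lborel)"
        by (intro nn_integral_le_towards_stationary[OF W_nonneg W_deriv W'_mono h h_nonneg _
              \<psi>_pos[OF t(1)] trunc(2)[OF t(1) t(1) t(1)] c0 _ int zero])
           (use h_supp in \<open>auto simp: not_less[symmetric]\<close>)
      then show ?thesis by (simp add: h_def t_def)
    qed
  qed
  then have "(\<integral>\<^sup>+u. \<integral>\<^sup>+s. ennreal (W (?\<psi>' (l * u) * s) * (s * f (s, s * u))) \<partial>lborel \<partial>lborel)
      \<le> (\<integral>\<^sup>+u. \<integral>\<^sup>+s. ennreal (W (\<psi> (l * u) * s) * (s * f (s, s * u))) \<partial>lborel \<partial>lborel)"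
    using AE_ratio_mass_finite[OF f] by (intro nn_integral_mono_AE) auto
  moreover have "risk1 W f \<theta> (equivariant \<psi>) =
      (\<integral>\<^sup>+u. \<integral>\<^sup>+s. ennreal (W (\<psi> (l * u) * s) * (s * f (s, s * u))) \<partial>lborel \<partial>lborel)"
    unfolding l_def using W_nonneg \<psi>_pos
    by (intro risk1_equivariant[OF f W_meas _ \<psi>_meas _ \<theta>(1,2)]) auto
  moreover have "risk1 W f \<theta> (equivariant ?\<psi>') =
      (\<integral>\<^sup>+u. \<integral>\<^sup>+s. ennreal (W (?\<psi>' (l * u) * s) * (s * f (s, s * u))) \<partial>lborel \<partial>lborel)"
    unfolding l_def using W_nonneg trunc(2)
    by (intro risk1_equivariant[OF f W_meas _ trunc_meas _ \<theta>(1,2)]) auto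
  ultimately show "risk1 W f \<theta> (equivariant ?\<psi>') \<le> risk1 W f \<theta> (equivariant \<psi>)"
    by simp
qed

end
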